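(* Let $G$ be an $n$-vertex graph other than the book $B_n$. If $\delta(G)\ge 2$ and $uv\in E(G)$, then $G$ has an overlap representation $f$ with size $|E(G)|-1$ such that neither $f(u)$ nor $f(v)$ is properly contained in the set assigned to any other vertex. In particular, if $\delta(G)\ge 2$, then $\varphi(G)\le |E(G)|-1$ unless $G$ is the $3$-book $K_3$.
   Context: Graphs are finite and simple; $\delta(G)$ is the minimum vertex degree. Two sets overlap if they intersect but neither contains the other. An overlap representation of a graph $G$ is an assignment $f$ of sets to the vertices of $G$ such that, for distinct vertices $u,v$, $uv\in E(G)$ if and only if $f(u)$ and $f(v)$ overlap. When the assigned sets are finite, the size of $f$ is $\left|\bigcup_{v\in V(G)} f(v)\right|$. The overlap number $\varphi(G)$ is the minimum size of an overlap representation of $G$ by finite sets. The $n$-book $B_n$ ($n\ge 3$) is the $n$-vertex graph that is the union of $n-2$ triangles having a common edge; in particular $B_3=K_3$. *)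

theory Defs
  imports Main
begin

text \<open>A graph is given by its vertex set and its set of edges, each edge being a two-element
  set of vertices.\<close>

definition fin_simple_graph :: "'a set \<Rightarrow> 'a set set \<Rightarrow> bool" where
  "fin_simple_graph V E \<longleftrightarrow> finite V \<and> (\<forall>e\<in>E. e \<subseteq> V \<and> card e = 2)"

definition degree :: "'a set set \<Rightarrow> 'a \<Rightarrow> nat" where
  "degree E v = card {e \<in> E. v \<in> e}"

text \<open>Only meaningful for nonempty \<open>V\<close>.\<close>

definition min_degree :: "'a set \<Rightarrow> 'a set set \<Rightarrow> nat" where
  "min_degree V E = Min (degree E ` V)"

definition graph_iso :: "'a set \<Rightarrow> 'a set set \<Rightarrow> 'b set \<Rightarrow> 'b set set \<Rightarrow> bool" where
  "graph_iso V E V' E' \<longleftrightarrow>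
     (\<exists>h. bij_betw h V V' \<and> (\<forall>x\<in>V. \<forall>y\<in>V. {x, y} \<in> E \<longleftrightarrow> {h x, h y} \<in> E'))"

text \<open>The \<open>n\<close>-book on the vertices \<open>0, \<dots>, n - 1\<close>: its triangles are \<open>{0, 1, i}\<close> for
  \<open>2 \<le> i < n\<close>, so their common edge is \<open>{0, 1}\<close>.\<close>

definition book_edges :: "nat \<Rightarrow> nat set set" where
  "book_edges n = (\<Union>i\<in>{2..<n}. {{0, 1}, {0, i}, {1, i}})"

definition is_book :: "nat \<Rightarrow> 'a set \<Rightarrow> 'a set set \<Rightarrow> bool" where
  "is_book n V E \<longleftrightarrow> 3 \<le> n \<and> graph_iso V E {..<n} (book_edges n)"

definition overlap :: "'b set \<Rightarrow> 'b set \<Rightarrow> bool" where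
  "overlap A B \<longleftrightarrow> A \<inter> B \<noteq> {} \<and> \<not> A \<subseteq> B \<and> \<not> B \<subseteq> A"

definition overlap_rep :: "'a set \<Rightarrow> 'a set set \<Rightarrow> ('a \<Rightarrow> 'b set) \<Rightarrow> bool" where
  "overlap_rep V E f \<longleftrightarrow>
     (\<forall>x\<in>V. \<forall>y\<in>V. x \<noteq> y \<longrightarrow> ({x, y} \<in> E \<longleftrightarrow> overlap (f x) (f y)))"

definition finite_overlap_rep :: "'a set \<Rightarrow> 'a set set \<Rightarrow> ('a \<Rightarrow> 'b set) \<Rightarrow> bool" where
  "finite_overlap_rep V E f \<longleftrightarrow> overlap_rep V E f \<and> (\<forall>x\<in>V. finite (f x))"

definition rep_size :: "'a set \<Rightarrow> ('a \<Rightarrow> 'b set) \<Rightarrow> nat" where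
  "rep_size V f = card (\<Union>x\<in>V. f x)"

text \<open>Taking all assigned sets to be sets of natural numbers is no restriction: the union of
  finitely many finite sets can be relabelled injectively by natural numbers.\<close>

definition overlap_number :: "'a set \<Rightarrow> 'a set set \<Rightarrow> nat" where
  "overlap_number V E =
     (LEAST k. \<exists>f :: 'a \<Rightarrow> nat set. finite_overlap_rep V E f \<and> rep_size V f = k)"

end

theory Submission
  imports Defs
begin

text \<open>Assigning to every vertex the set of its incident edges gives an overlap representation
  with \<open>card E\<close> elements. To save the element \<open>{u, v}\<close>, turn the sets of \<open>u\<close> and \<open>v\<close> inside out:
  \<open>u\<close> gets the edges that avoid \<open>u\<close>, and \<open>v\<close> those that avoid \<open>v\<close>. A non-neighbour of \<open>u\<close> has
  all its edges in the set of \<open>u\<close>, while a neighbour \<open>w \<noteq> v\<close> of \<open>u\<close> has exactly one edge outside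
  that set and, as its degree is at least two, one inside. So everything is fine as long as the set
  of \<open>u\<close> meets that of \<open>v\<close> and lies in none of the sets of the vertices \<open>w \<noteq> v\<close>, and likewise for
  \<open>v\<close>. All this says that for \<open>x \<in> {u, v}\<close> and any other vertex \<open>w\<close> some edge avoids both \<open>x\<close> and
  \<open>w\<close>; see \<open>inverted_edge_rep\<close>.

  If this fails, then \<open>{x, w}\<close> is a vertex cover for some \<open>x \<in> {u, v}\<close> and some \<open>w\<close>. All other
  vertices are then adjacent to exactly \<open>x\<close> and \<open>w\<close>, by the degree condition
  (\<open>edge_iff_of_vertex_cover\<close>), so the graph is a book if \<open>x\<close> and \<open>w\<close> are adjacent, and a complete
  bipartite graph with parts \<open>{x, w}\<close> and the rest otherwise. Non-adjacent vertices with the same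
  neighbours may share a set, so both kinds of graph have representations by three elements
  (\<open>rep_of_nonadjacent_vertex_cover\<close>, \<open>overlap_number_book\<close>), and this is at most \<open>card E - 1\<close> as
  soon as \<open>x\<close> and \<open>w\<close> have two common neighbours. Only the triangle escapes.\<close>

section \<open>Overlap representations and books\<close>

text \<open>Edges serve as the elements of the sets, hence representations have to be relabelled by
  natural numbers in the end.\<close>

lemma relabel_by_nat:
  fixes g :: "'a \<Rightarrow> 'b set"
  assumes "finite V" and rep: "finite_overlap_rep V E g"
  obtains f :: "'a \<Rightarrow> nat set" where "finite_overlap_rep V E f" "rep_size V f = rep_size V g"
    "\<And>x y. x \<in> V \<Longrightarrow> y \<in> V \<Longrightarrow> f x \<subset> f y \<longleftrightarrow> g x \<subset> g y"
proof -
  let ?U = "\<Union>x\<in>V. g x"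
  have fin: "finite ?U"
    using assms by (auto simp: finite_overlap_rep_def)
  then obtain h :: "'b \<Rightarrow> nat" where h: "inj_on h ?U"
    using finite_imp_inj_to_nat_seg by metis
  have sub: "h ` g x \<subseteq> h ` g y \<longleftrightarrow> g x \<subseteq> g y" if "x \<in> V" "y \<in> V" for x y
    using that inj_on_image_mem_iff[OF h] by blast
  have int: "h ` g x \<inter> h ` g y = {} \<longleftrightarrow> g x \<inter> g y = {}" if "x \<in> V" "y \<in> V" for x y
  proof -
    have "h ` (g x \<inter> g y) = h ` g x \<inter> h ` g y"
      using that by (intro inj_on_image_Int[OF h]) auto
    then show ?thesis by (metis image_is_empty)
  qed
  show thesis
  proof
    show "finite_overlap_rep V E (\<lambda>x. h ` g x)"
      using rep sub int by (simp add: finite_overlap_rep_def overlap_rep_def overlap_def)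
    have "card (h ` ?U) = card ?U"
      using h by (rule card_image)
    then show "rep_size V (\<lambda>x. h ` g x) = rep_size V g"
      by (simp add: rep_size_def image_UN)
    show "h ` g x \<subset> h ` g y \<longleftrightarrow> g x \<subset> g y" if "x \<in> V" "y \<in> V" for x y
      using sub that by (simp add: less_le_not_le)
  qed
qed

lemma overlap_commute: "overlap A B \<longleftrightarrow> overlap B A"
  by (auto simp: overlap_def)

lemma overlap_number_le:
  fixes f :: "'a \<Rightarrow> nat set"
  assumes "finite_overlap_rep V E f" "rep_size V f \<le> k"
  shows "overlap_number V E \<le> k"
proof -
  have "overlap_number V E \<le> rep_size V f"
    unfolding overlap_number_def by (rule Least_le) (use assms(1) in blast)
  with assms(2) show ?thesis by simp
qed

lemma book_edge_iff:
  assumes "3 \<le> n"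
  shows "{i, j} \<in> book_edges n \<longleftrightarrow> i < n \<and> j < n \<and> i \<noteq> j \<and> (i < 2 \<or> j < 2)"
proof
  assume "{i, j} \<in> book_edges n"
  then obtain k where k: "2 \<le> k" "k < n" "{i, j} = {0, 1} \<or> {i, j} = {0, k} \<or> {i, j} = {1, k}"
    unfolding book_edges_def UN_iff insert_iff empty_iff by (metis atLeastLessThan_iff)
  from k(3) show "i < n \<and> j < n \<and> i \<noteq> j \<and> (i < 2 \<or> j < 2)"
    using k(1,2) by (elim disjE) (auto simp: doubleton_eq_iff)
next
  have spine: "{0, 1} \<in> book_edges n" using assms by (force simp: book_edges_def)
  have page: "{0, k} \<in> book_edges n" "{1, k} \<in> book_edges n" if "2 \<le> k" "k < n" for k
    using that by (force simp: book_edges_def)+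
  have edge: "{a, b} \<in> book_edges n" if "a < 2" "b < n" "a \<noteq> b" for a b
  proof (cases "b < 2")
    case True
    with that have "{a, b} = {0, 1}" by auto
    with spine show ?thesis by simp
  next
    case False
    moreover from that have "a = 0 \<or> a = 1" by auto
    ultimately show ?thesis using page[of b] that by auto
  qed
  assume "i < n \<and> j < n \<and> i \<noteq> j \<and> (i < 2 \<or> j < 2)"
  with edge[of i j] edge[of j i] show "{i, j} \<in> book_edges n" by (auto simp: insert_commute)
qed

section \<open>Graphs of minimum degree at least two\<close>

locale min_degree_two_graph =
  fixes V :: "'a set" and E :: "'a set set"
  assumes graph: "fin_simple_graph V E"
    and degree_ge_2: "v \<in> V \<Longrightarrow> 2 \<le> degree E v"
begin

lemma finite_V: "finite V" and finite_E: "finite E"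
proof -
  show "finite V" using graph by (simp add: fin_simple_graph_def)
  moreover have "E \<subseteq> Pow V" using graph by (auto simp: fin_simple_graph_def)
  ultimately show "finite E" by (meson finite_Pow_iff finite_subset)
qed

lemma edgeD: "{x, y} \<in> E \<Longrightarrow> x \<in> V \<and> y \<in> V \<and> x \<noteq> y"
  using graph by (force simp: fin_simple_graph_def)

lemma edge_cases:
  assumes "e \<in> E" "x \<in> e"
  obtains y where "e = {x, y}" "x \<noteq> y"
proof -
  from assms graph have "card e = 2" by (simp add: fin_simple_graph_def)
  then obtain a b where "e = {a, b}" "a \<noteq> b" by (auto simp: card_2_iff)
  with \<open>x \<in> e\<close> have "e = {x, b} \<and> x \<noteq> b \<or> e = {x, a} \<and> x \<noteq> a" by auto
  with that show thesis by blast
qed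

lemma edge_eqI: "e \<in> E \<Longrightarrow> x \<in> e \<Longrightarrow> y \<in> e \<Longrightarrow> x \<noteq> y \<Longrightarrow> e = {x, y}"
  by (elim edge_cases) auto

lemma other_edge:
  assumes "x \<in> V"
  obtains y where "{x, y} \<in> E" "{x, y} \<noteq> d"
proof -
  have "\<not> {e \<in> E. x \<in> e} \<subseteq> {d}"
  proof
    assume "{e \<in> E. x \<in> e} \<subseteq> {d}"
    then have "card {e \<in> E. x \<in> e} \<le> card {d}" by (intro card_mono) auto
    with degree_ge_2[OF assms] show False by (simp add: degree_def)
  qed
  then obtain e where e: "e \<in> E" "x \<in> e" "e \<noteq> d" by blast
  with edge_cases[of e x] that show thesis by metis
qed

lemma four_le_card_edges:
  assumes "distinct [x, w, a, b]" "{x, a} \<in> E" "{x, b} \<in> E" "{w, a} \<in> E" "{w, b} \<in> E"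
  shows "4 \<le> card E"
proof -
  have "card {{x, a}, {x, b}, {w, a}, {w, b}} = 4"
    using assms(1) by (auto simp: doubleton_eq_iff)
  moreover have "{{x, a}, {x, b}, {w, a}, {w, b}} \<subseteq> E" using assms by auto
  ultimately show ?thesis using card_mono[OF finite_E] by metis
qed

section \<open>Inverting the edge sets at the ends of an edge\<close>

text \<open>The element that is saved is \<open>{u, v}\<close>: once inverted, the sets of \<open>u\<close> and \<open>v\<close> no longer
  contain it, and they overlap because an edge that avoids both is a common element and each of the
  two vertices has a further edge, which avoids the other.\<close>

lemma inverted_edge_rep:
  assumes uv: "{u, v} \<in> E"
    and avoid: "\<And>x w. x \<in> {u, v} \<Longrightarrow> w \<in> V \<Longrightarrow> w \<noteq> x \<Longrightarrow> \<exists>e\<in>E. x \<notin> e \<and> w \<notin> e"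
  obtains g :: "'a \<Rightarrow> 'a set set" where "finite_overlap_rep V E g" "rep_size V g = card E - 1"
    "\<And>x w. x \<in> {u, v} \<Longrightarrow> w \<in> V \<Longrightarrow> \<not> g x \<subset> g w"
proof -
  define g where "g w = (if w \<in> {u, v} then {e \<in> E. w \<notin> e} else {e \<in> E. w \<in> e})" for w
  have V: "u \<in> V" "v \<in> V" "u \<noteq> v" using edgeD[OF uv] by auto
  have not_sub: "\<not> g x \<subseteq> g w" if xw: "x \<in> {u, v}" "w \<in> V" "w \<noteq> x" for x w
  proof (cases "w \<in> {u, v}")
    case True
    then obtain y where "{w, y} \<in> E" "{w, y} \<noteq> {w, x}" using other_edge[OF \<open>w \<in> V\<close>] by metis
    then show ?thesis using xw True by (auto simp: g_def)
  next
    case False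
    then show ?thesis using avoid[OF xw] xw by (auto simp: g_def)
  qed
  then have not_psub: "\<not> g x \<subset> g w" if "x \<in> {u, v}" "w \<in> V" for x w
    using that by blast
  have ov_uv: "overlap (g u) (g v)"
    using not_sub[of u v] not_sub[of v u] avoid[of u v] V by (auto simp: overlap_def g_def)
  have ov_inv: "overlap (g x) (g w) \<longleftrightarrow> {x, w} \<in> E" if xw: "x \<in> {u, v}" "w \<in> V - {u, v}" for x w
  proof
    assume "{x, w} \<in> E"
    moreover obtain y where "{w, y} \<in> E" "{w, y} \<noteq> {w, x}" using other_edge[of w] xw by blast
    moreover have "x \<noteq> w" "x \<noteq> y" using xw \<open>{w, y} \<noteq> {w, x}\<close> by auto
    ultimately have "g x \<inter> g w \<noteq> {}" "{x, w} \<in> g w - g x" using xw by (auto simp: g_def)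
    with not_sub[of x w] xw show "overlap (g x) (g w)" by (auto simp: overlap_def)
  next
    assume "overlap (g x) (g w)"
    then obtain e where "e \<in> g w" "e \<notin> g x" by (auto simp: overlap_def)
    then have "e \<in> E" "w \<in> e" "x \<in> e" using xw by (auto simp: g_def)
    then show "{x, w} \<in> E" using edge_eqI[of e x w] xw by auto
  qed
  have ov_plain: "overlap (g x) (g w) \<longleftrightarrow> {x, w} \<in> E"
    if xw: "x \<in> V - {u, v}" "w \<in> V - {u, v}" "x \<noteq> w" for x w
  proof
    have not_sub': "\<not> g x \<subseteq> g w" if xw: "x \<in> V - {u, v}" "w \<in> V - {u, v}" "x \<noteq> w" for x w
    proof -
      obtain y where "{x, y} \<in> E" "{x, y} \<noteq> {x, w}" using other_edge[of x] xw by blast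
      then show ?thesis using xw by (auto simp: g_def)
    qed
    assume "{x, w} \<in> E"
    then have "{x, w} \<in> g x \<inter> g w" using xw by (auto simp: g_def)
    with not_sub'[of x w] not_sub'[of w x] xw show "overlap (g x) (g w)"
      by (auto simp: overlap_def)
  next
    assume "overlap (g x) (g w)"
    then obtain e where "e \<in> E" "w \<in> e" "x \<in> e" using xw by (auto simp: overlap_def g_def)
    then show "{x, w} \<in> E" using edge_eqI[of e x w] xw by auto
  qed
  have "{x, w} \<in> E \<longleftrightarrow> overlap (g x) (g w)" if xw: "x \<in> V" "w \<in> V" "x \<noteq> w" for x w
  proof (cases "x \<in> {u, v}")
    case True
    then show ?thesis
      using ov_inv[of x w] ov_uv uv xw by (cases "w \<in> {u, v}") (auto simp: overlap_commute insert_commute)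
  next
    case False
    then show ?thesis
      using ov_inv[of w x] ov_plain[of x w] xw
      by (cases "w \<in> {u, v}") (auto simp: overlap_commute insert_commute)
  qed
  then have rep: "finite_overlap_rep V E g"
    using finite_E by (simp add: finite_overlap_rep_def overlap_rep_def g_def)
  have "(\<Union>w\<in>V. g w) = E - {{u, v}}"
  proof (intro equalityI subsetI)
    fix e assume "e \<in> (\<Union>w\<in>V. g w)"
    then show "e \<in> E - {{u, v}}" by (auto simp: g_def split: if_splits)
  next
    fix e assume e: "e \<in> E - {{u, v}}"
    then have "e \<subseteq> V" "card e = 2" using graph by (auto simp: fin_simple_graph_def)
    then have "\<not> e \<subseteq> {u, v}" using card_subset_eq[of "{u, v}" e] e V by auto
    with \<open>e \<subseteq> V\<close> obtain w where "w \<in> e" "w \<in> V" "w \<notin> {u, v}" by auto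
    then have "e \<in> g w" using e by (auto simp: g_def)
    with \<open>w \<in> V\<close> show "e \<in> (\<Union>w\<in>V. g w)" by blast
  qed
  then have "rep_size V g = card E - 1" using uv finite_E by (simp add: rep_size_def)
  with rep not_psub that show thesis by blast
qed

section \<open>Graphs with a vertex cover of size two\<close>

text \<open>A vertex outside the cover has all its edges going into the cover, and it has at least two.\<close>

lemma edge_iff_of_vertex_cover:
  assumes cover: "\<And>e. e \<in> E \<Longrightarrow> x \<in> e \<or> w \<in> e"
    and yz: "y \<in> V - {x, w}"
  shows "{y, z} \<in> E \<longleftrightarrow> z \<in> {x, w}"
proof
  assume "{y, z} \<in> E"
  from cover[OF this] yz show "z \<in> {x, w}" by auto
next
  \<comment> \<open>An edge at \<open>y\<close> different from the one leading to \<open>x\<close> must lead to \<open>w\<close>, and vice versa.\<close>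
  obtain p where "{y, p} \<in> E" "{y, p} \<noteq> {y, x}" using other_edge[of y] yz by blast
  moreover from cover[OF this(1)] yz have "p \<in> {x, w}" by auto
  ultimately have "{y, w} \<in> E" by auto
  obtain q where "{y, q} \<in> E" "{y, q} \<noteq> {y, w}" using other_edge[of y] yz by blast
  moreover from cover[OF this(1)] yz have "q \<in> {x, w}" by auto
  ultimately have "{y, x} \<in> E" by auto
  with \<open>{y, w} \<in> E\<close> show "z \<in> {x, w} \<Longrightarrow> {y, z} \<in> E" by auto
qed

lemma is_book_of_adjacent_vertex_cover:
  assumes cover: "\<And>e. e \<in> E \<Longrightarrow> x \<in> e \<or> w \<in> e"
    and xw: "{x, w} \<in> E"
  shows "is_book (card V) V E"
proof -
  let ?n = "card V" and ?L = "V - {x, w}"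
  have V: "x \<in> V" "w \<in> V" "x \<noteq> w" using edgeD[OF xw] by auto
  obtain y where "{x, y} \<in> E" "{x, y} \<noteq> {x, w}" using other_edge[OF V(1)] by blast
  with edgeD have "y \<in> ?L" by fastforce
  have cL: "card ?L = ?n - 2" using V finite_V by (simp add: card_Diff_subset)
  moreover have "card ?L > 0" using \<open>y \<in> ?L\<close> finite_V by (auto simp: card_gt_0_iff)
  ultimately have n: "3 \<le> ?n" by simp
  obtain k where k: "bij_betw k ?L {2..<?n}"
    using finite_same_card_bij[of ?L "{2..<?n}"] finite_V cL by auto
  define h where "h a = (if a = x then 0 else if a = w then 1 else k a)" for a
  have "bij_betw h ?L {2..<?n}"
    using k by (rule bij_betw_cong[THEN iffD1, rotated]) (auto simp: h_def)
  moreover have "bij_betw h {x, w} {0, 1}" using V by (auto simp: bij_betw_def h_def)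
  ultimately have "bij_betw h (?L \<union> {x, w}) ({2..<?n} \<union> {0, 1})"
    by (rule bij_betw_combine) auto
  moreover have "?L \<union> {x, w} = V" "{2..<?n} \<union> {0, 1} = {..<?n}" using V n by auto
  ultimately have bij: "bij_betw h V {..<?n}" by simp
  have hL: "2 \<le> h a \<and> h a < ?n" if "a \<in> ?L" for a
    using bij_betwE[OF k] that by (auto simp: h_def)
  note book = book_edge_iff[OF n]
  have hx: "h x = 0" "h w = 1" using V by (auto simp: h_def)
  have "{a, b} \<in> E \<longleftrightarrow> {h a, h b} \<in> book_edges ?n" if ab: "a \<in> V" "b \<in> V" for a b
  proof (cases "a \<in> ?L")
    case True
    with edge_iff_of_vertex_cover[OF cover True, of b] hL[of a] hL[of b] hx ab show ?thesis
      by (auto simp: book)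
  next
    case False
    show ?thesis
    proof (cases "b \<in> ?L")
      case True
      with edge_iff_of_vertex_cover[OF cover True, of a] hL[of b] hx ab False show ?thesis
        by (auto simp: book insert_commute)
    next
      case False
      with \<open>a \<notin> ?L\<close> ab have "a \<in> {x, w}" "b \<in> {x, w}" by auto
      moreover have "{a, b} \<in> E \<longleftrightarrow> a \<noteq> b" using calculation xw edgeD[of a b] by (auto simp: insert_commute)
      moreover have "h a = h b \<longleftrightarrow> a = b" "h a < 2" "h b < 2" using calculation(1,2) hx by auto
      ultimately show ?thesis using n by (simp add: book)
    qed
  qed
  with bij n show ?thesis by (auto simp: is_book_def graph_iso_def)
qed

text \<open>Here the graph is complete bipartite with parts \<open>{x, w}\<close> and the rest, and \<open>{0, 1}\<close> and
  \<open>{1, 2}\<close> for the two parts already represent it; the further elements of the set of \<open>x\<close> bring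
  the size up to \<open>card E - 1\<close> without enclosing the set of \<open>x\<close> in another one.\<close>

lemma rep_of_nonadjacent_vertex_cover:
  assumes cover: "\<And>e. e \<in> E \<Longrightarrow> x \<in> e \<or> w \<in> e"
    and V: "x \<in> V" "w \<in> V" "x \<noteq> w" and xw: "{x, w} \<notin> E" and xy: "{x, y} \<in> E"
  obtains f :: "'a \<Rightarrow> nat set" where "finite_overlap_rep V E f" "rep_size V f = card E - 1"
    "\<And>z p. z \<in> {x, y} \<Longrightarrow> p \<in> V \<Longrightarrow> \<not> f z \<subset> f p"
proof -
  have iff: "{p, q} \<in> E \<longleftrightarrow> q \<in> {x, w}" if "p \<in> V - {x, w}" for p q
    using edge_iff_of_vertex_cover[OF cover that] by simp
  define f where "f p = (if p = x then {0, 1} \<union> {3..<card E - 1}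
    else if p = w then {0, 1} else {1, 2::nat})" for p
  have y: "y \<in> V - {x, w}" using edgeD[OF xy] xy xw by auto
  obtain z where z: "{x, z} \<in> E" "{x, z} \<noteq> {x, y}" using other_edge[OF V(1)] by blast
  then have "z \<in> V - {x, w}" "z \<noteq> y" using edgeD[of x z] xw by auto
  have "{y, x} \<in> E" "{z, x} \<in> E" "{y, w} \<in> E" "{z, w} \<in> E"
    using iff y \<open>z \<in> V - {x, w}\<close> by blast+
  then have "4 \<le> card E"
    using y \<open>z \<in> V - {x, w}\<close> \<open>z \<noteq> y\<close> V
    by (intro four_le_card_edges[of y z x w]) auto
  have fx: "f x = {0, 1} \<union> {3..<card E - 1}" and fw: "f w = {0, 1}"
    using V by (auto simp: f_def)
  have fL: "f p = {1, 2}" if "p \<in> V - {x, w}" for p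
    using that by (auto simp: f_def)
  have parts: "overlap (f p) (f q) \<longleftrightarrow> (p \<in> {x, w}) \<noteq> (q \<in> {x, w})" if "p \<in> V" "q \<in> V" for p q
  proof -
    have "p \<in> V - {x, w} \<or> p = x \<or> p = w" "q \<in> V - {x, w} \<or> q = x \<or> q = w" using that by auto
    then show ?thesis
      using V by (elim disjE) (auto simp: fx fw fL overlap_def)
  qed
  have edges: "{p, q} \<in> E \<longleftrightarrow> (p \<in> {x, w}) \<noteq> (q \<in> {x, w})" if "p \<in> V" "q \<in> V" for p q
  proof (cases "p \<in> {x, w}")
    case False
    with iff[of p q] that show ?thesis by auto
  next
    case p: True
    show ?thesis
    proof (cases "q \<in> {x, w}")
      case False
      with iff[of q p] that p show ?thesis by (auto simp: insert_commute)
    next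
      case True
      with p have "{p, q} = {x, w} \<or> p = q" by auto
      with p True xw edgeD[of p q] show ?thesis by auto
    qed
  qed
  show thesis
  proof
    show "finite_overlap_rep V E f"
      unfolding finite_overlap_rep_def overlap_rep_def
    proof (intro conjI ballI impI)
      show "{p, q} \<in> E \<longleftrightarrow> overlap (f p) (f q)" if "p \<in> V" "q \<in> V" for p q
        unfolding parts[OF that] edges[OF that] ..
    qed (simp add: f_def)
    have "(\<Union>p\<in>V. f p) = f x \<union> f w \<union> f y"
    proof (intro equalityI subsetI)
      fix i assume "i \<in> (\<Union>p\<in>V. f p)"
      then show "i \<in> f x \<union> f w \<union> f y" using fL[OF y] by (auto simp: f_def split: if_splits)
    qed (use V y in blast)
    also have "\<dots> = {..<card E - 1}" using \<open>4 \<le> card E\<close> by (auto simp: fx fw fL[OF y])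
    finally show "rep_size V f = card E - 1" by (simp add: rep_size_def)
    show "\<not> f z \<subset> f p" if "z \<in> {x, y}" "p \<in> V" for z p
    proof -
      have "f p = f x \<or> f p = {0, 1} \<or> f p = {1, 2}" by (auto simp: f_def)
      moreover have "f z = f x \<or> f z = {1, 2}" using that fL[OF y] by blast
      moreover have "{0, 1} \<subseteq> f x" "2 \<notin> f x" by (auto simp: fx)
      moreover have "2 \<notin> {0, 1::nat}" "0 \<notin> {1, 2::nat}" by simp_all
      ultimately show ?thesis by blast
    qed
  qed
qed

section \<open>The upper bound\<close>

lemma rep_of_edge:
  assumes uv: "{u, v} \<in> E" and "\<not> is_book (card V) V E"
  obtains f :: "'a \<Rightarrow> nat set" where "finite_overlap_rep V E f" "rep_size V f = card E - 1"
    "\<And>z p. z \<in> {u, v} \<Longrightarrow> p \<in> V \<Longrightarrow> \<not> f z \<subset> f p"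
proof (cases "\<exists>x\<in>{u, v}. \<exists>w\<in>V. w \<noteq> x \<and> (\<forall>e\<in>E. x \<in> e \<or> w \<in> e)")
  case True
  then obtain x w where x: "x \<in> {u, v}" and w: "w \<in> V" "x \<noteq> w"
    and cover: "\<And>e. e \<in> E \<Longrightarrow> x \<in> e \<or> w \<in> e" by auto
  from x obtain y where y: "{u, v} = {x, y}" by auto
  have xw: "{x, w} \<notin> E" using is_book_of_adjacent_vertex_cover[OF cover] assms(2) by blast
  have xy: "{x, y} \<in> E" using uv y by simp
  then have "x \<in> V" using edgeD by blast
  from rep_of_nonadjacent_vertex_cover[OF cover this w xw xy] show thesis
    using that unfolding y by blast
next
  case False
  then have avoid: "\<exists>e\<in>E. x \<notin> e \<and> w \<notin> e" if "x \<in> {u, v}" "w \<in> V" "w \<noteq> x" for x w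
    using that by blast
  show thesis
  proof (rule inverted_edge_rep[OF uv avoid])
    fix g :: "'a \<Rightarrow> 'a set set"
    assume g: "finite_overlap_rep V E g" "rep_size V g = card E - 1"
      "\<And>x w. x \<in> {u, v} \<Longrightarrow> w \<in> V \<Longrightarrow> \<not> g x \<subset> g w"
    show thesis
    proof (rule relabel_by_nat[OF finite_V g(1)])
      fix f :: "'a \<Rightarrow> nat set"
      assume f: "finite_overlap_rep V E f" "rep_size V f = rep_size V g"
        "\<And>x y. x \<in> V \<Longrightarrow> y \<in> V \<Longrightarrow> f x \<subset> f y \<longleftrightarrow> g x \<subset> g y"
      show thesis
      proof (rule that[OF f(1)])
        show "rep_size V f = card E - 1" using f(2) g(2) by simp
        fix z p assume zp: "z \<in> {u, v}" "p \<in> V"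
        then have "z \<in> V" using edgeD[OF uv] by auto
        then show "\<not> f z \<subset> f p" using g(3)[OF zp] f(3)[of z p] zp by simp
      qed
    qed
  qed
qed

text \<open>All pages of a book receive the same set, so three elements suffice, and a book with at
  least two pages has at least four edges.\<close>

lemma overlap_number_book:
  assumes "is_book n V E" "n \<noteq> 3"
  shows "overlap_number V E \<le> card E - 1"
proof -
  from assms obtain h where n: "4 \<le> n" and h: "bij_betw h V {..<n}"
    and E: "\<And>x y. x \<in> V \<Longrightarrow> y \<in> V \<Longrightarrow> {x, y} \<in> E \<longleftrightarrow> {h x, h y} \<in> book_edges n"
    by (auto simp: is_book_def graph_iso_def)
  have book: "{i, j} \<in> book_edges n \<longleftrightarrow> i \<noteq> j \<and> (i < 2 \<or> j < 2)" if "i < n" "j < n" for i j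
    using book_edge_iff[of n i j] n that by simp
  have inj: "x = y" if "h x = h y" "x \<in> V" "y \<in> V" for x y
    using h that by (auto simp: bij_betw_def inj_on_def)
  have lt: "h x < n" if "x \<in> V" for x using bij_betwE[OF h] that by auto
  define p where "p = inv_into V h"
  have p: "p i \<in> V" "h (p i) = i" if "i < n" for i
  proof -
    have "i \<in> h ` V" using that h by (auto simp: bij_betw_def)
    then show "p i \<in> V" "h (p i) = i" unfolding p_def by (rule inv_into_into, rule f_inv_into_f)
  qed
  have p_eq: "p i = p j \<longleftrightarrow> i = j" if "i < n" "j < n" for i j
    using p that by metis
  have "4 \<le> card E"
    by (rule four_le_card_edges[of "p 0" "p 1" "p 2" "p 3"])
      (use n in \<open>simp_all add: p_eq E p book\<close>)
  define f where "f x = (if h x = 0 then {0, 1} else if h x = 1 then {0, 2} else {1, 2::nat})" for x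
  have "finite_overlap_rep V E f"
    unfolding finite_overlap_rep_def overlap_rep_def
  proof (intro conjI ballI impI)
    fix x y assume xy: "x \<in> V" "y \<in> V" "x \<noteq> y"
    then have "h x \<noteq> h y" using inj by blast
    then show "{x, y} \<in> E \<longleftrightarrow> overlap (f x) (f y)"
      unfolding E[OF xy(1,2)] book[OF lt[OF xy(1)] lt[OF xy(2)]] f_def overlap_def by auto
  qed (auto simp: f_def)
  moreover have "(\<Union>x\<in>V. f x) \<subseteq> {0, 1, 2}" by (auto simp: f_def)
  then have "card (\<Union>x\<in>V. f x) \<le> card {0, 1, 2::nat}" by (intro card_mono) auto
  then have "rep_size V f \<le> card E - 1" using \<open>4 \<le> card E\<close> by (simp add: rep_size_def)
  ultimately show ?thesis by (rule overlap_number_le)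
qed

end

theorem lemma3p6:
  fixes V :: "'a set" and E :: "'a set set"
  assumes "fin_simple_graph V E" and "V \<noteq> {}" and "min_degree V E \<ge> 2"
  shows "(\<not> is_book (card V) V E \<longrightarrow>
            (\<forall>u v. {u, v} \<in> E \<longrightarrow>
               (\<exists>f :: 'a \<Rightarrow> nat set.
                  finite_overlap_rep V E f \<and> rep_size V f = card E - 1 \<and>
                  (\<forall>w\<in>V. w \<noteq> u \<longrightarrow> \<not> f u \<subset> f w) \<and>
                  (\<forall>w\<in>V. w \<noteq> v \<longrightarrow> \<not> f v \<subset> f w)))) \<and>
         (\<not> is_book 3 V E \<longrightarrow> overlap_number V E \<le> card E - 1)"
proof -
  have fin: "finite V" using assms(1) by (simp add: fin_simple_graph_def)
  have "2 \<le> degree E x" if "x \<in> V" for x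
  proof -
    have "min_degree V E \<le> degree E x"
      unfolding min_degree_def using fin that by (intro Min_le) auto
    with assms(3) show ?thesis by simp
  qed
  with assms(1) interpret min_degree_two_graph V E by unfold_locales
  show ?thesis
  proof (intro conjI impI allI)
    fix u v assume "\<not> is_book (card V) V E" "{u, v} \<in> E"
    from rep_of_edge[OF this(2,1)]
    show "\<exists>f :: 'a \<Rightarrow> nat set. finite_overlap_rep V E f \<and> rep_size V f = card E - 1 \<and>
        (\<forall>w\<in>V. w \<noteq> u \<longrightarrow> \<not> f u \<subset> f w) \<and> (\<forall>w\<in>V. w \<noteq> v \<longrightarrow> \<not> f v \<subset> f w)"
      by (metis insertCI)
  next
    assume not3: "\<not> is_book 3 V E"
    show "overlap_number V E \<le> card E - 1"
    proof (cases "is_book (card V) V E")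
      case True
      with not3 show ?thesis using overlap_number_book by metis
    next
      case False
      obtain x where "x \<in> V" using assms(2) by blast
      then obtain y where "{x, y} \<in> E" using other_edge by blast
      from rep_of_edge[OF this False] show ?thesis using overlap_number_le by (metis order_refl)
    qed
  qed
qed

end
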